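(* Let $\pi_c$ and $\nu_c$ be two elements of $\mathcal{Q}_+(\mathcal{X})$, $0<\xi<1/2$, $x\in\mathbb{R}$, and $$T(\boldsymbol{X})=\log\left(\frac{dQ_{\pi_m}}{dQ_{\nu_m}}(\boldsymbol{X})\right)-2x,$$ where, for a measure $\lambda\in\mathcal{Q}_+(\mathcal{X})$ dominating $\pi_c$ and $\nu_c$ and with densities taken with respect to $\lambda$, the measures $\pi_m,\nu_m\in\mathcal{Q}_+(\mathcal{X})$ are defined by $$\sqrt{d\pi_m}=\xi\sqrt{d\nu_c}+(1-\xi)\sqrt{d\pi_c}\quad\text{and}\quad\sqrt{d\nu_m}=\xi\sqrt{d\pi_c}+(1-\xi)\sqrt{d\nu_c}.$$ Define a test function $\psi$ with values in $\{\pi_c,\nu_c\}$ by $\psi(\boldsymbol{X})=\pi_c$ when $T(\boldsymbol{X})>0$, $\psi(\boldsymbol{X})=\nu_c$ when $T(\boldsymbol{X})<0$ ($\psi(\boldsymbol{X})$ being arbitrary if $T(\boldsymbol{X})=0$). If $\boldsymbol{X}$ is a Poisson process with mean measure $\mu\in\mathcal{Q}_+(\mathcal{X})$, then $$\mathbb{P}_\mu[\psi(\boldsymbol{X})=\pi_c]\le\exp\left[-x-(1-2\xi)^2H^2(\pi_c,\nu_c)\right]\quad\text{if } H(\mu,\nu_c)\le\xi H(\pi_c,\nu_c)$$ and $$\mathbb{P}_\mu[\psi(\boldsymbol{X})=\nu_c]\le\exp\left[x-(1-2\xi)^2H^2(\pi_c,\nu_c)\right]\quad\text{if } H(\mu,\pi_c)\le\xi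 H(\pi_c,\nu_c).$$
   Context: $(\mathcal{X},\mathcal{E})$ is a measurable space and $\mathcal{Q}_+(\mathcal{X})$ the set of finite positive measures on it. A Poisson process with mean measure $\mu\in\mathcal{Q}_+(\mathcal{X})$ is a point process $\boldsymbol{X}=\{X_1,\dots,X_N\}$ such that $N$ is Poisson with parameter $\mu(\mathcal{X})$ and, conditionally on $N$, the $X_i$ are i.i.d. with distribution $\mu/\mu(\mathcal{X})$; $Q_\mu$ denotes its distribution and $\mathbb{P}_\mu$ probability when $\boldsymbol{X}$ has mean measure $\mu$. If $\mu\ll\nu$, then $Q_\mu\ll Q_\nu$ with $\frac{dQ_\mu}{dQ_\nu}(X_1,\dots,X_N)=\exp[\nu(\mathcal{X})-\mu(\mathcal{X})]\prod_{i=1}^N\frac{d\mu}{d\nu}(X_i)$ (an empty product equals 1). For $\mu,\mu'\in\mathcal{Q}_+(\mathcal{X})$, $H^2(\mu,\mu')=\frac12\int(\sqrt{d\mu/d\nu}-\sqrt{d\mu'/d\nu})^2d\nu$ for any measure $\nu$ dominating both, and $H\ge0$.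
   Formalization: The density of π_m with respect to ν_m is taken as the quotient of their λ-densities with 0/0 = 1 (for an arbitrary version the bounds can fail when μ charges the common null set), and the two values of ψ are treated as distinct labels even if π_c = ν_c. *)

theory Defs
  imports "HOL-Probability.Probability"
begin

section \<open>Finite positive measures and their densities\<close>

text \<open>The measurable space \<open>(\<X>, \<E>)\<close> is given by \<open>space M\<close> and \<open>sets M\<close>; the values of
  the measure \<open>M\<close> itself play no role.\<close>

definition finite_measures :: "'a measure \<Rightarrow> 'a measure set" where
  "finite_measures M = {\<mu>. finite_measure \<mu> \<and> sets \<mu> = sets M}"

text \<open>\<open>f\<close> is an everywhere finite version of the density of \<open>\<mu>\<close> with respect to \<open>\<nu>\<close>; in
  particular \<open>\<nu>\<close> dominates \<open>\<mu>\<close>.\<close>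

definition is_density :: "('a \<Rightarrow> real) \<Rightarrow> 'a measure \<Rightarrow> 'a measure \<Rightarrow> bool" where
  "is_density f \<mu> \<nu> \<longleftrightarrow>
     f \<in> borel_measurable \<nu> \<and> (\<forall>x\<in>space \<nu>. 0 \<le> f x) \<and> \<mu> = density \<nu> (\<lambda>x. ennreal (f x))"

text \<open>If \<open>p\<close> and \<open>q\<close> are densities of two measures with respect to a common one, the density of
  the first measure with respect to the second is their quotient, with the convention
  \<open>0/0 = 1\<close>. The convention matters when this density is evaluated at the points of a process
  whose mean measure the second measure does not dominate.\<close>

definition density_ratio :: "('a \<Rightarrow> real) \<Rightarrow> ('a \<Rightarrow> real) \<Rightarrow> 'a \<Rightarrow> real" where
  "density_ratio p q x = (if p x = 0 \<and> q x = 0 then 1 else p x / q x)"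

section \<open>Hellinger distance\<close>

definition measure_sum :: "'a measure \<Rightarrow> 'a measure \<Rightarrow> 'a measure" where
  "measure_sum \<mu> \<mu>' = measure_of (space \<mu>) (sets \<mu>) (\<lambda>A. emeasure \<mu> A + emeasure \<mu>' A)"

text \<open>The definition takes \<open>\<mu> + \<mu>'\<close> as dominating measure; by \<open>hellinger_eq\<close> below, any other
  one gives the same value.\<close>

definition hellinger :: "'a measure \<Rightarrow> 'a measure \<Rightarrow> real" where
  "hellinger \<mu> \<mu>' = (let \<nu> = measure_sum \<mu> \<mu>' in
     sqrt (1/2 * (\<integral>x. (sqrt (enn2real (RN_deriv \<nu> \<mu> x)) - sqrt (enn2real (RN_deriv \<nu> \<mu>' x)))\<^sup>2 \<partial>\<nu>)))"

section \<open>Poisson processes\<close>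

text \<open>A realization \<open>{X\<^sub>1, \<dots>, X\<^sub>N}\<close> is a finite multiset of points (repetitions are possible when
  the mean measure has atoms). Configurations carry the \<open>\<sigma>\<close>-algebra generated by the counts of
  points in measurable sets.\<close>

definition config_space :: "'a measure \<Rightarrow> 'a multiset measure" where
  "config_space M = sigma {c. set_mset c \<subseteq> space M}
     {{c. set_mset c \<subseteq> space M \<and> size (filter_mset (\<lambda>x. x \<in> A) c) = k} | A k. A \<in> sets M}"

text \<open>The distribution of a Poisson process with mean measure \<open>\<mu>\<close>: \<open>N\<close> is Poisson with parameter
  \<open>\<mu>(\<X>)\<close> and, given \<open>N = n\<close>, the \<open>n\<close> points are i.i.d. with distribution \<open>\<mu>/\<mu>(\<X>)\<close>. The
  library's Poisson distribution needs a positive parameter; parameter 0 means \<open>N = 0\<close>.\<close>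

definition poisson_law :: "'a measure \<Rightarrow> 'a multiset measure" where
  "poisson_law \<mu> =
     (if emeasure \<mu> (space \<mu>) = 0 then return (config_space \<mu>) {#}
      else measure_pmf (poisson_pmf (measure \<mu> (space \<mu>))) \<bind>
        (\<lambda>n. distr (PiM {..<n} (\<lambda>_. uniform_measure \<mu> (space \<mu>))) (config_space \<mu>)
               (\<lambda>y. mset (map y [0..<n]))))"

definition poisson_process :: "'w measure \<Rightarrow> ('w \<Rightarrow> 'a multiset) \<Rightarrow> 'a measure \<Rightarrow> bool" where
  "poisson_process P X \<mu> \<longleftrightarrow>
     prob_space P \<and> X \<in> P \<rightarrow>\<^sub>M config_space \<mu> \<and> distr P (config_space \<mu>) X = poisson_law \<mu>"

text \<open>The density of \<open>poisson_law \<mu>\<close> with respect to \<open>poisson_law \<nu>\<close>, where \<open>h\<close> is a density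
  of \<open>\<mu>\<close> with respect to \<open>\<nu>\<close>; see \<open>poisson_law_density\<close> below.\<close>

definition poisson_density :: "('a \<Rightarrow> real) \<Rightarrow> 'a measure \<Rightarrow> 'a measure \<Rightarrow> 'a multiset \<Rightarrow> real" where
  "poisson_density h \<mu> \<nu> c =
     exp (measure \<nu> (space \<nu>) - measure \<mu> (space \<mu>)) * (\<Prod>x\<in>#c. h x)"

section \<open>The test\<close>

text \<open>The density of the measure \<open>m\<close> with \<open>\<surd>dm = \<xi> \<surd>ds + (1 - \<xi>) \<surd>dt\<close>, where \<open>s\<close> and \<open>t\<close> are
  given by their densities.\<close>

definition mix_density :: "real \<Rightarrow> ('a \<Rightarrow> real) \<Rightarrow> ('a \<Rightarrow> real) \<Rightarrow> 'a \<Rightarrow> real" where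
  "mix_density \<xi> s t x = (\<xi> * sqrt (s x) + (1 - \<xi>) * sqrt (t x))\<^sup>2"

text \<open>The two values \<open>\<pi>\<^sub>c\<close> and \<open>\<nu>\<^sub>c\<close> of a test, as labels, so that they remain distinguishable if
  the two measures coincide.\<close>

datatype decision = Choose_pi | Choose_nu

section \<open>The density of the law of a Poisson process\<close>

lemma space_config_space [simp]: "space (config_space M) = {c. set_mset c \<subseteq> space M}"
  unfolding config_space_def by (rule space_measure_of) auto

lemma sets_config_space_cong: "sets M = sets N \<Longrightarrow> sets (config_space M) = sets (config_space N)"
  using sets_eq_imp_space_eq[of M N] by (simp add: config_space_def)

lemma config_count_measurable:
  assumes "A \<in> sets M"
  shows "(\<lambda>c. size (filter_mset (\<lambda>x. x \<in> A) c)) \<in> config_space M \<rightarrow>\<^sub>M count_space UNIV"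
proof (rule measurableI)
  fix S :: "nat set"
  have m: "{c. set_mset c \<subseteq> space M \<and> size (filter_mset (\<lambda>x. x \<in> A) c) = k} \<in> sets (config_space M)" for k
    unfolding config_space_def using assms by (subst sets_measure_of) auto
  have "(\<lambda>c. size (filter_mset (\<lambda>x. x \<in> A) c)) -` S \<inter> space (config_space M)
      = (\<Union>k\<in>S. {c. set_mset c \<subseteq> space M \<and> size (filter_mset (\<lambda>x. x \<in> A) c) = k})"
    by auto
  also have "\<dots> \<in> sets (config_space M)"
    using m by (intro sets.countable_UN') auto
  finally show "(\<lambda>c. size (filter_mset (\<lambda>x. x \<in> A) c)) -` S \<inter> space (config_space M) \<in> sets (config_space M)" .
qed simp

lemma size_filter_mset_map:
  "size (filter_mset P (mset (map y [0..<n]))) = (\<Sum>i<n. if P (y i) then 1 else 0 :: nat)"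
  by (induction n) auto

lemma measurable_mset_map:
  assumes "sets \<mu> = sets M"
  shows "(\<lambda>y. mset (map y [0..<n])) \<in> PiM {..<n} (\<lambda>_. \<mu>) \<rightarrow>\<^sub>M config_space M"
  unfolding config_space_def
proof (rule measurable_measure_of)
  have sp: "space \<mu> = space M" using assms by (rule sets_eq_imp_space_eq)
  have sub: "set_mset (mset (map y [0..<n])) \<subseteq> space M" if "y \<in> space (PiM {..<n} (\<lambda>_. \<mu>))" for y
    using PiE_mem[OF that[unfolded space_PiM]] by (auto simp: sp)
  then show "(\<lambda>y. mset (map y [0..<n])) \<in> space (PiM {..<n} (\<lambda>_. \<mu>)) \<rightarrow> {c. set_mset c \<subseteq> space M}"
    by blast
  fix S assume "S \<in> {{c. set_mset c \<subseteq> space M \<and> size (filter_mset (\<lambda>x. x \<in> A) c) = k} | A k. A \<in> sets M}"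
  then obtain A k where A: "A \<in> sets \<mu>"
    and S: "S = {c. set_mset c \<subseteq> space M \<and> size (filter_mset (\<lambda>x. x \<in> A) c) = k}"
    using assms by auto
  note A[measurable]
  have "(\<lambda>y. mset (map y [0..<n])) -` S \<inter> space (PiM {..<n} (\<lambda>_. \<mu>))
     = {y \<in> space (PiM {..<n} (\<lambda>_. \<mu>)). (\<Sum>i<n. if y i \<in> A then 1 else 0 :: nat) = k}"
    unfolding S size_filter_mset_map[where P = "\<lambda>x. x \<in> A", symmetric]
    using sub by blast
  also have "\<dots> \<in> sets (PiM {..<n} (\<lambda>_. \<mu>))" by measurable
  finally show "(\<lambda>y. mset (map y [0..<n])) -` S \<inter> space (PiM {..<n} (\<lambda>_. \<mu>)) \<in> sets (PiM {..<n} (\<lambda>_. \<mu>))" .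
qed auto

lemma prod_mset_fibres:
  fixes g :: "'a \<Rightarrow> real"
  assumes "finite V" "\<forall>x\<in>set_mset c. g x \<in> V"
  shows "(\<Prod>x\<in>#c. g x) = (\<Prod>v\<in>V. v ^ size (filter_mset (\<lambda>x. g x = v) c))"
  using assms(2)
proof (induction c)
  case (add a c)
  have "(\<Prod>v\<in>V. v ^ size (filter_mset (\<lambda>x. g x = v) (add_mset a c)))
      = (\<Prod>v\<in>V. (if g a = v then v else 1) * v ^ size (filter_mset (\<lambda>x. g x = v) c))"
    by (intro prod.cong) auto
  also have "\<dots> = g a * (\<Prod>v\<in>V. v ^ size (filter_mset (\<lambda>x. g x = v) c))"
    using add.prems assms(1) by (simp add: prod.distrib)
  finally show ?case using add by simp
qed auto

lemma measurable_prod_mset: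
  fixes h :: "'a \<Rightarrow> real"
  assumes h: "h \<in> borel_measurable M"
  shows "(\<lambda>c. \<Prod>x\<in>#c. h x) \<in> borel_measurable (config_space M)"
proof -
  obtain F where F: "\<And>i::nat. simple_function M (F i)" "\<And>x. x \<in> space M \<Longrightarrow> (\<lambda>i. F i x) \<longlonglongrightarrow> h x"
    using borel_measurable_implies_sequence_metric[OF h, of 0] by blast
  show ?thesis
  proof (rule borel_measurable_LIMSEQ_real)
    fix c assume "c \<in> space (config_space M)"
    then have "set_mset c \<subseteq> space M" by simp
    then show "(\<lambda>i. \<Prod>x\<in>#c. F i x) \<longlonglongrightarrow> (\<Prod>x\<in>#c. h x)"
      by (induction c) (auto intro!: tendsto_mult F)
  next
    fix i
    define V where "V = F i ` space M"
    have V: "finite V" using F(1)[of i] by (simp add: V_def simple_function_def)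
    have m: "{x \<in> space M. F i x = v} \<in> sets M" for v
      using borel_measurable_simple_function[OF F(1)[of i]] by measurable
    have cm: "(\<lambda>c. size (filter_mset (\<lambda>x. x \<in> {x \<in> space M. F i x = v}) c)) \<in> config_space M \<rightarrow>\<^sub>M count_space UNIV" for v
      by (rule config_count_measurable[OF m])
    have pm: "(\<lambda>c. v ^ size (filter_mset (\<lambda>x. x \<in> {x \<in> space M. F i x = v}) c)) \<in> borel_measurable (config_space M)" for v
      by (rule measurable_compose[OF cm]) simp
    have "(\<lambda>c. \<Prod>v\<in>V. v ^ size (filter_mset (\<lambda>x. x \<in> {x \<in> space M. F i x = v}) c)) \<in> borel_measurable (config_space M)"
      by (intro borel_measurable_prod pm)
    then show "(\<lambda>c. \<Prod>x\<in>#c. F i x) \<in> borel_measurable (config_space M)"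
    proof (rule measurable_cong[THEN iffD2, rotated])
      fix c assume "c \<in> space (config_space M)"
      then have c: "set_mset c \<subseteq> space M" by simp
      have "(\<Prod>x\<in>#c. F i x) = (\<Prod>v\<in>V. v ^ size (filter_mset (\<lambda>x. F i x = v) c))"
        using c by (intro prod_mset_fibres V) (auto simp: V_def)
      also have "\<dots> = (\<Prod>v\<in>V. v ^ size (filter_mset (\<lambda>x. x \<in> {x \<in> space M. F i x = v}) c))"
      proof (rule prod.cong)
        fix v assume "v \<in> V"
        have "filter_mset (\<lambda>x. F i x = v) c = filter_mset (\<lambda>x. x \<in> {x \<in> space M. F i x = v}) c"
          by (rule filter_mset_cong) (use c in auto)
        then show "v ^ size (filter_mset (\<lambda>x. F i x = v) c)
            = v ^ size (filter_mset (\<lambda>x. x \<in> {x \<in> space M. F i x = v}) c)" by simp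
      qed simp
      finally show "(\<Prod>x\<in>#c. F i x) = (\<Prod>v\<in>V. v ^ size (filter_mset (\<lambda>x. x \<in> {x \<in> space M. F i x = v}) c))" .
    qed
  qed
qed

lemma finite_measure_imp_product: "finite_measure \<mu> \<Longrightarrow> product_sigma_finite (\<lambda>_. \<mu>)"
  by (simp add: product_sigma_finite_def finite_measure.sigma_finite_measure)

lemma sets_poisson_law [simp]: "sets (poisson_law \<mu>) = sets (config_space \<mu>)"
  by (simp add: poisson_law_def)

lemma PiM_uniform_scale:
  assumes "finite_measure \<mu>" and m: "0 < measure \<mu> (space \<mu>)"
  shows "PiM {..<n} (\<lambda>_. \<mu>) =
    scale_measure (ennreal (measure \<mu> (space \<mu>) ^ n)) (PiM {..<n} (\<lambda>_. uniform_measure \<mu> (space \<mu>)))"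
proof -
  interpret finite_measure \<mu> by fact
  interpret U: prob_space "uniform_measure \<mu> (space \<mu>)"
    using m by (intro prob_space_uniform_measure) (auto simp: emeasure_eq_measure)
  interpret PU: product_prob_space "\<lambda>_. uniform_measure \<mu> (space \<mu>)" "{..<n}" ..
  interpret PM: product_sigma_finite "\<lambda>_. \<mu>" by (rule finite_measure_imp_product) fact
  show ?thesis
  proof (rule PM.PiM_eqI[symmetric])
    fix A :: "nat \<Rightarrow> 'a set" assume A: "\<And>i. i \<in> {..<n} \<Longrightarrow> A i \<in> sets \<mu>"
    have "emeasure (PiM {..<n} (\<lambda>_. uniform_measure \<mu> (space \<mu>))) (Pi\<^sub>E {..<n} A)
        = (\<Prod>i<n. emeasure (uniform_measure \<mu> (space \<mu>)) (A i))"
      using A by (intro PU.emeasure_PiM) auto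
    also have "\<dots> = (\<Prod>i<n. ennreal (measure \<mu> (A i) / measure \<mu> (space \<mu>)))"
    proof (intro prod.cong refl)
      fix i assume "i \<in> {..<n}"
      then have "A i \<in> sets \<mu>" using A by auto
      then show "emeasure (uniform_measure \<mu> (space \<mu>)) (A i) = ennreal (measure \<mu> (A i) / measure \<mu> (space \<mu>))"
        using m sets.sets_into_space[of "A i" \<mu>]
        by (simp add: emeasure_eq_measure divide_ennreal Int_absorb1)
    qed
    also have "\<dots> = ennreal (\<Prod>i<n. measure \<mu> (A i) / measure \<mu> (space \<mu>))"
      by (simp add: prod_ennreal)
    finally have "emeasure (scale_measure (ennreal (measure \<mu> (space \<mu>) ^ n)) (PiM {..<n} (\<lambda>_. uniform_measure \<mu> (space \<mu>)))) (Pi\<^sub>E {..<n} A)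
       = ennreal (measure \<mu> (space \<mu>) ^ n * (\<Prod>i<n. measure \<mu> (A i) / measure \<mu> (space \<mu>)))"
      by (simp add: ennreal_mult' )
    also have "\<dots> = ennreal (\<Prod>i<n. measure \<mu> (A i))"
      using m by (simp add: prod_dividef)
    also have "\<dots> = (\<Prod>i<n. emeasure \<mu> (A i))"
      by (simp add: emeasure_eq_measure prod_ennreal)
    finally show "emeasure (scale_measure (ennreal (measure \<mu> (space \<mu>) ^ n)) (PiM {..<n} (\<lambda>_. uniform_measure \<mu> (space \<mu>)))) (Pi\<^sub>E {..<n} A)
       = (\<Prod>i\<in>{..<n}. emeasure \<mu> (A i))" .
  qed (simp_all cong: sets_PiM_cong)
qed

lemma nn_integral_poisson_law:
  assumes "finite_measure \<mu>" and F: "F \<in> borel_measurable (config_space \<mu>)"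
  shows "(\<integral>\<^sup>+c. F c \<partial>poisson_law \<mu>) =
    (\<Sum>n. ennreal (exp (- measure \<mu> (space \<mu>)) / fact n) * (\<integral>\<^sup>+y. F (mset (map y [0..<n])) \<partial>PiM {..<n} (\<lambda>_. \<mu>)))"
proof -
  interpret finite_measure \<mu> by fact
  let ?m = "measure \<mu> (space \<mu>)" and ?U = "uniform_measure \<mu> (space \<mu>)"
  have Fn: "(\<lambda>y. F (mset (map y [0..<n]))) \<in> borel_measurable (PiM {..<n} (\<lambda>_. \<mu>))" for n
    by (rule measurable_compose[OF measurable_mset_map F]) simp
  show ?thesis
  proof (cases "emeasure \<mu> (space \<mu>) = 0")
    case True
    interpret PM: product_sigma_finite "\<lambda>_. \<mu>" by (rule finite_measure_imp_product) fact
    have "(\<integral>\<^sup>+y. F (mset (map y [0..<n])) \<partial>PiM {..<n} (\<lambda>_. \<mu>)) = 0" if "n \<noteq> 0" for n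
    proof (rule nn_integral_zero')
      have "emeasure (PiM {..<n} (\<lambda>_. \<mu>)) (Pi\<^sub>E {..<n} (\<lambda>_. space \<mu>)) = (\<Prod>i<n. emeasure \<mu> (space \<mu>))"
        by (rule PM.emeasure_PiM) auto
      then have "emeasure (PiM {..<n} (\<lambda>_. \<mu>)) (space (PiM {..<n} (\<lambda>_. \<mu>))) = 0"
        using that True by (simp add: space_PiM)
      then show "AE y in PiM {..<n} (\<lambda>_. \<mu>). F (mset (map y [0..<n])) = 0"
        by (intro AE_I[where N = "space (PiM {..<n} (\<lambda>_. \<mu>))"]) auto
    qed
    then have z: "ennreal (exp (- ?m) / fact n) * (\<integral>\<^sup>+y. F (mset (map y [0..<n])) \<partial>PiM {..<n} (\<lambda>_. \<mu>)) = 0" if "n \<notin> {0}" for n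
      using that by simp
    have "(\<Sum>n. ennreal (exp (- ?m) / fact n) * (\<integral>\<^sup>+y. F (mset (map y [0..<n])) \<partial>PiM {..<n} (\<lambda>_. \<mu>))) =
      (\<Sum>n\<in>{0}. ennreal (exp (- ?m) / fact n) * (\<integral>\<^sup>+y. F (mset (map y [0..<n])) \<partial>PiM {..<n} (\<lambda>_. \<mu>)))"
      using z by (intro suminf_finite) auto
    also have "\<dots> = F {#}"
      using True by (simp add: PiM_empty nn_integral_count_space_finite measure_def)
    also have "\<dots> = (\<integral>\<^sup>+c. F c \<partial>poisson_law \<mu>)"
      using True F by (simp add: poisson_law_def nn_integral_return)
    finally show ?thesis by simp
  next
    case False
    then have m: "0 < ?m" by (simp add: emeasure_eq_measure less_le)
    interpret U: prob_space ?U
      using m by (intro prob_space_uniform_measure) (auto simp: emeasure_eq_measure)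
    have sU: "sets (PiM {..<n} (\<lambda>_. ?U)) = sets (PiM {..<n} (\<lambda>_. \<mu>))" for n :: nat
      by (intro sets_PiM_cong) auto
    have mU: "(\<lambda>y. mset (map y [0..<n])) \<in> PiM {..<n} (\<lambda>_. ?U) \<rightarrow>\<^sub>M config_space \<mu>" for n
      by (rule measurable_mset_map) simp
    have FnU: "(\<lambda>y. F (mset (map y [0..<n]))) \<in> borel_measurable (PiM {..<n} (\<lambda>_. ?U))" for n
      by (rule measurable_compose[OF mU F])
    have Fd: "(\<integral>\<^sup>+c. F c \<partial>distr (PiM {..<n} (\<lambda>_. ?U)) (config_space \<mu>) (\<lambda>y. mset (map y [0..<n])))
        = (\<integral>\<^sup>+y. F (mset (map y [0..<n])) \<partial>PiM {..<n} (\<lambda>_. ?U))" for n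
      by (rule nn_integral_distr[OF mU]) (use F in simp)
    have K: "(\<lambda>n. distr (PiM {..<n} (\<lambda>_. ?U)) (config_space \<mu>) (\<lambda>y. mset (map y [0..<n])))
        \<in> measure_pmf (poisson_pmf ?m) \<rightarrow>\<^sub>M subprob_algebra (config_space \<mu>)"
    proof -
      have "distr (PiM {..<n} (\<lambda>_. ?U)) (config_space \<mu>) (\<lambda>y. mset (map y [0..<n])) \<in> space (subprob_algebra (config_space \<mu>))" for n
      proof -
        have "prob_space (distr (PiM {..<n} (\<lambda>_. ?U)) (config_space \<mu>) (\<lambda>y. mset (map y [0..<n])))"
          by (intro prob_space.prob_space_distr prob_space_PiM mU U.prob_space_axioms)
        then show ?thesis by (simp add: space_subprob_algebra prob_space_imp_subprob_space)
      qed
      then show ?thesis by simp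
    qed
    have "(\<integral>\<^sup>+c. F c \<partial>poisson_law \<mu>) =
       (\<integral>\<^sup>+n. (\<integral>\<^sup>+y. F (mset (map y [0..<n])) \<partial>PiM {..<n} (\<lambda>_. ?U)) \<partial>measure_pmf (poisson_pmf ?m))"
      using False unfolding poisson_law_def by (simp only: if_False nn_integral_bind[OF F K] Fd)
    also have "\<dots> = (\<Sum>n. ennreal (pmf (poisson_pmf ?m) n) * (\<integral>\<^sup>+y. F (mset (map y [0..<n])) \<partial>PiM {..<n} (\<lambda>_. ?U)))"
      by (simp add: nn_integral_measure_pmf nn_integral_count_space_nat del: pmf_poisson)
    also have "\<dots> = (\<Sum>n. ennreal (exp (- ?m) / fact n) * (\<integral>\<^sup>+y. F (mset (map y [0..<n])) \<partial>PiM {..<n} (\<lambda>_. \<mu>)))"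
    proof (intro suminf_cong)
      fix n
      have "(\<integral>\<^sup>+y. F (mset (map y [0..<n])) \<partial>PiM {..<n} (\<lambda>_. \<mu>))
          = ennreal (?m ^ n) * (\<integral>\<^sup>+y. F (mset (map y [0..<n])) \<partial>PiM {..<n} (\<lambda>_. ?U))"
        by (subst PiM_uniform_scale[OF assms(1) m]) (rule nn_integral_scale_measure[OF FnU])
      then show "ennreal (pmf (poisson_pmf ?m) n) * (\<integral>\<^sup>+y. F (mset (map y [0..<n])) \<partial>PiM {..<n} (\<lambda>_. ?U))
         = ennreal (exp (- ?m) / fact n) * (\<integral>\<^sup>+y. F (mset (map y [0..<n])) \<partial>PiM {..<n} (\<lambda>_. \<mu>))"
        using m by (simp add: mult.assoc[symmetric] ennreal_mult'[symmetric] field_simps)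
    qed
    finally show ?thesis .
  qed
qed

lemma prob_space_poisson_law:
  assumes "finite_measure \<mu>"
  shows "prob_space (poisson_law \<mu>)"
proof
  interpret finite_measure \<mu> by fact
  interpret PM: product_sigma_finite "\<lambda>_. \<mu>" by (rule finite_measure_imp_product) fact
  let ?m = "measure \<mu> (space \<mu>)"
  have "emeasure (PiM {..<n} (\<lambda>_. \<mu>)) (Pi\<^sub>E {..<n} (\<lambda>_. space \<mu>)) = (\<Prod>i<n. emeasure \<mu> (space \<mu>))" for n :: nat
    by (rule PM.emeasure_PiM) auto
  then have sp: "emeasure (PiM {..<n} (\<lambda>_. \<mu>)) (space (PiM {..<n} (\<lambda>_. \<mu>))) = ennreal (?m ^ n)" for n :: nat
    by (simp add: space_PiM emeasure_eq_measure ennreal_power)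
  have "emeasure (poisson_law \<mu>) (space (poisson_law \<mu>)) = (\<integral>\<^sup>+c. 1 \<partial>poisson_law \<mu>)"
    by simp
  also have "\<dots> = (\<Sum>n. ennreal (exp (- ?m) / fact n) * ennreal (?m ^ n))"
    by (subst nn_integral_poisson_law) (simp_all add: assms sp)
  also have "\<dots> = (\<Sum>n. ennreal (exp (- ?m) * (?m ^ n /\<^sub>R fact n)))"
    by (intro suminf_cong) (simp add: ennreal_mult'[symmetric] field_simps)
  also have "\<dots> = ennreal (exp (- ?m) * exp ?m)"
    by (intro suminf_ennreal_eq sums_mult exp_converges) simp
  finally show "emeasure (poisson_law \<mu>) (space (poisson_law \<mu>)) = 1"
    by (simp add: mult_exp_exp)
qed

lemma prod_mset_map_upt: "(\<Prod>x\<in>#mset (map y [0..<n]). h x) = (\<Prod>i<n. h (y i :: 'a) :: 'b :: comm_monoid_mult)"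
  by (induction n) (auto simp: mult.commute)

lemma PiM_density:
  assumes "finite_measure \<nu>" "finite_measure \<mu>" and h: "is_density h \<mu> \<nu>"
  shows "PiM {..<n :: nat} (\<lambda>_. \<mu>) = density (PiM {..<n} (\<lambda>_. \<nu>)) (\<lambda>y. ennreal (\<Prod>i<n. h (y i)))"
proof -
  interpret PM: product_sigma_finite "\<lambda>_. \<mu>" by (rule finite_measure_imp_product) fact
  interpret PN: product_sigma_finite "\<lambda>_. \<nu>" by (rule finite_measure_imp_product) fact
  have hm[measurable]: "h \<in> borel_measurable \<nu>" and h0: "\<And>x. x \<in> space \<nu> \<Longrightarrow> 0 \<le> h x"
    and mu: "\<mu> = density \<nu> (\<lambda>x. ennreal (h x))"
    using h by (auto simp: is_density_def)
  have sm: "sets \<mu> = sets \<nu>" by (simp add: mu)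
  show ?thesis
  proof (rule PM.PiM_eqI[symmetric])
    show "sets (density (PiM {..<n} (\<lambda>_. \<nu>)) (\<lambda>y. ennreal (\<Prod>i<n. h (y i)))) = sets (PiM {..<n} (\<lambda>_. \<mu>))"
      by (simp add: sm cong: sets_PiM_cong)
  next
    fix A :: "nat \<Rightarrow> 'a set" assume "\<And>i. i \<in> {..<n} \<Longrightarrow> A i \<in> sets \<mu>"
    then have A[measurable]: "\<And>i. i \<in> {..<n} \<Longrightarrow> A i \<in> sets \<nu>" by (simp add: sm)
    have B: "Pi\<^sub>E {..<n} A \<in> sets (PiM {..<n} (\<lambda>_. \<nu>))"
      by (intro sets_PiM_I_finite A) auto
    have "emeasure (density (PiM {..<n} (\<lambda>_. \<nu>)) (\<lambda>y. ennreal (\<Prod>i<n. h (y i)))) (Pi\<^sub>E {..<n} A)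
       = (\<integral>\<^sup>+y. ennreal (\<Prod>i<n. h (y i)) * indicator (Pi\<^sub>E {..<n} A) y \<partial>PiM {..<n} (\<lambda>_. \<nu>))"
      using B by (intro emeasure_density) auto
    also have "\<dots> = (\<integral>\<^sup>+y. (\<Prod>i<n. ennreal (h (y i)) * indicator (A i) (y i)) \<partial>PiM {..<n} (\<lambda>_. \<nu>))"
    proof (intro nn_integral_cong)
      fix y assume y: "y \<in> space (PiM {..<n} (\<lambda>_. \<nu>))"
      then have y0: "0 \<le> h (y i)" if "i < n" for i
        using h0 PiE_mem[OF y[unfolded space_PiM]] that by auto
      have "(\<Prod>i<n. indicator (A i) (y i) :: ennreal) = indicator (Pi\<^sub>E {..<n} A) y"
        using y by (auto simp: indicator_def space_PiM PiE_def Pi_def intro!: prod.neutral split: if_splits)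
      then show "ennreal (\<Prod>i<n. h (y i)) * indicator (Pi\<^sub>E {..<n} A) y
          = (\<Prod>i<n. ennreal (h (y i)) * indicator (A i) (y i))"
        using prod_ennreal[of "{..<n}" "\<lambda>i. h (y i)"] y0 by (simp add: prod.distrib)
    qed
    also have "\<dots> = (\<Prod>i<n. \<integral>\<^sup>+x. ennreal (h x) * indicator (A i) x \<partial>\<nu>)"
      by (intro PN.product_nn_integral_prod) auto
    also have "\<dots> = (\<Prod>i<n. emeasure \<mu> (A i))"
      unfolding mu by (intro prod.cong refl emeasure_density[symmetric]) auto
    finally show "emeasure (density (PiM {..<n} (\<lambda>_. \<nu>)) (\<lambda>y. ennreal (\<Prod>i<n. h (y i)))) (Pi\<^sub>E {..<n} A)
       = (\<Prod>i\<in>{..<n}. emeasure \<mu> (A i))" .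
  qed simp
qed

theorem poisson_law_density:
  assumes "finite_measure \<nu>" "finite_measure \<mu>" and h: "is_density h \<mu> \<nu>"
  shows "is_density (poisson_density h \<mu> \<nu>) (poisson_law \<mu>) (poisson_law \<nu>)"
  unfolding is_density_def
proof (intro conjI ballI)
  have hm[measurable]: "h \<in> borel_measurable \<nu>" and h0: "\<And>x. x \<in> space \<nu> \<Longrightarrow> 0 \<le> h x"
    and mu: "\<mu> = density \<nu> (\<lambda>x. ennreal (h x))"
    using h by (auto simp: is_density_def)
  have sm: "sets \<mu> = sets \<nu>" by (simp add: mu)
  have sc: "sets (config_space \<mu>) = sets (config_space \<nu>)" by (rule sets_config_space_cong[OF sm])
  have Dm: "poisson_density h \<mu> \<nu> \<in> borel_measurable (config_space \<nu>)"
    unfolding poisson_density_def[abs_def]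
    by (intro borel_measurable_times measurable_prod_mset hm) simp
  then show "poisson_density h \<mu> \<nu> \<in> borel_measurable (poisson_law \<nu>)"
    by (simp cong: measurable_cong_sets)
  have pos: "0 \<le> (\<Prod>x\<in>#c. h x)" if "set_mset c \<subseteq> space \<nu>" for c
    using that by (induction c) (auto simp: h0)
  {
    fix c assume "c \<in> space (poisson_law \<nu>)"
    then have "c \<in> space (config_space \<nu>)"
      using sets_eq_imp_space_eq[OF sets_poisson_law] by blast
    then show "0 \<le> poisson_density h \<mu> \<nu> c"
      using pos by (simp add: poisson_density_def)
  }
  let ?e = "exp (measure \<nu> (space \<nu>) - measure \<mu> (space \<mu>))"
  show "poisson_law \<mu> = density (poisson_law \<nu>) (\<lambda>c. ennreal (poisson_density h \<mu> \<nu> c))"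
  proof (rule measure_eqI)
    show "sets (poisson_law \<mu>) = sets (density (poisson_law \<nu>) (\<lambda>c. ennreal (poisson_density h \<mu> \<nu> c)))"
      by (simp add: sc)
    fix S assume "S \<in> sets (poisson_law \<mu>)"
    then have S: "S \<in> sets (config_space \<nu>)" and S': "S \<in> sets (config_space \<mu>)" by (simp_all add: sc)
    have "emeasure (density (poisson_law \<nu>) (\<lambda>c. ennreal (poisson_density h \<mu> \<nu> c))) S
       = (\<integral>\<^sup>+c. ennreal (poisson_density h \<mu> \<nu> c) * indicator S c \<partial>poisson_law \<nu>)"
      using S Dm by (intro emeasure_density) (auto cong: measurable_cong_sets)
    also have "\<dots> = (\<Sum>n. ennreal (exp (- measure \<nu> (space \<nu>)) / fact n) *
        (\<integral>\<^sup>+y. ennreal (poisson_density h \<mu> \<nu> (mset (map y [0..<n]))) * indicator S (mset (map y [0..<n])) \<partial>PiM {..<n} (\<lambda>_. \<nu>)))"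
      using S Dm by (intro nn_integral_poisson_law assms) auto
    also have "\<dots> = (\<Sum>n. ennreal (exp (- measure \<mu> (space \<mu>)) / fact n) *
        (\<integral>\<^sup>+y. indicator S (mset (map y [0..<n])) \<partial>PiM {..<n} (\<lambda>_. \<mu>)))"
    proof (intro suminf_cong)
      fix n
      have I: "(\<lambda>y. indicator S (mset (map y [0..<n])) :: ennreal) \<in> borel_measurable (PiM {..<n} (\<lambda>_. \<nu>))"
        by (rule measurable_compose[OF measurable_mset_map[OF refl]]) (use S in auto)
      have P: "(\<lambda>y. ennreal (\<Prod>i<n. h (y i))) \<in> borel_measurable (PiM {..<n} (\<lambda>_. \<nu>))"
        by measurable
      have "(\<integral>\<^sup>+y. ennreal (poisson_density h \<mu> \<nu> (mset (map y [0..<n]))) * indicator S (mset (map y [0..<n])) \<partial>PiM {..<n} (\<lambda>_. \<nu>))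
          = (\<integral>\<^sup>+y. ennreal ?e * (ennreal (\<Prod>i<n. h (y i)) * indicator S (mset (map y [0..<n]))) \<partial>PiM {..<n} (\<lambda>_. \<nu>))"
        unfolding poisson_density_def prod_mset_map_upt by (simp add: ennreal_mult' mult.assoc)
      also have "\<dots> = ennreal ?e * (\<integral>\<^sup>+y. ennreal (\<Prod>i<n. h (y i)) * indicator S (mset (map y [0..<n])) \<partial>PiM {..<n} (\<lambda>_. \<nu>))"
        using I P by (intro nn_integral_cmult) auto
      also have "\<dots> = ennreal ?e * (\<integral>\<^sup>+y. indicator S (mset (map y [0..<n])) \<partial>PiM {..<n} (\<lambda>_. \<mu>))"
        by (subst PiM_density[OF assms]) (simp only: nn_integral_density[OF P I])
      finally show "ennreal (exp (- measure \<nu> (space \<nu>)) / fact n) *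
        (\<integral>\<^sup>+y. ennreal (poisson_density h \<mu> \<nu> (mset (map y [0..<n]))) * indicator S (mset (map y [0..<n])) \<partial>PiM {..<n} (\<lambda>_. \<nu>))
        = ennreal (exp (- measure \<mu> (space \<mu>)) / fact n) *
        (\<integral>\<^sup>+y. indicator S (mset (map y [0..<n])) \<partial>PiM {..<n} (\<lambda>_. \<mu>))"
        by (simp add: mult.assoc[symmetric] ennreal_mult'[symmetric] mult_exp_exp)
    qed
    also have "\<dots> = (\<integral>\<^sup>+c. indicator S c \<partial>poisson_law \<mu>)"
      using S' by (intro nn_integral_poisson_law[symmetric] assms) auto
    also have "\<dots> = emeasure (poisson_law \<mu>) S" using S' by simp
    finally show "emeasure (poisson_law \<mu>) S = emeasure (density (poisson_law \<nu>) (\<lambda>c. ennreal (poisson_density h \<mu> \<nu> c))) S" by simp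
  qed
qed

lemma density_ratio_is_density:
  assumes p: "is_density p \<mu> \<kappa>" and q: "is_density q \<nu> \<kappa>"
    and ac: "\<And>x. x \<in> space \<kappa> \<Longrightarrow> q x = 0 \<Longrightarrow> p x = 0"
  shows "is_density (density_ratio p q) \<mu> \<nu>"
proof -
  have [measurable]: "p \<in> borel_measurable \<kappa>" "q \<in> borel_measurable \<kappa>"
    and nn: "\<And>x. x \<in> space \<kappa> \<Longrightarrow> 0 \<le> p x" "\<And>x. x \<in> space \<kappa> \<Longrightarrow> 0 \<le> q x"
    and mu: "\<mu> = density \<kappa> (\<lambda>x. ennreal (p x))" and nu: "\<nu> = density \<kappa> (\<lambda>x. ennreal (q x))"
    using p q by (auto simp: is_density_def)
  have r[measurable]: "density_ratio p q \<in> borel_measurable \<kappa>"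
    unfolding density_ratio_def[abs_def] by measurable
  have "density \<nu> (\<lambda>x. ennreal (density_ratio p q x))
      = density \<kappa> (\<lambda>x. ennreal (q x) * ennreal (density_ratio p q x))"
    unfolding nu by (rule density_density_eq) auto
  also have "\<dots> = \<mu>" unfolding mu
  proof (intro density_cong AE_I2)
    fix x assume "x \<in> space \<kappa>"
    then show "ennreal (q x) * ennreal (density_ratio p q x) = ennreal (p x)"
      using nn[of x] ac[of x] by (auto simp: density_ratio_def ennreal_mult'[symmetric])
  qed auto
  finally show ?thesis
    using nn r by (auto simp: is_density_def density_ratio_def nu)
qed

lemma mix_density_zero_iff:
  assumes "0 < \<xi>" "\<xi> < 1" "0 \<le> s x" "0 \<le> t x"
  shows "mix_density \<xi> s t x = 0 \<longleftrightarrow> s x = 0 \<and> t x = 0"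
  using assms by (auto simp: mix_density_def add_nonneg_eq_0_iff)

text \<open>The likelihood ratio defining the test statistic is indeed the density of the law with mean
  measure \<open>\<pi>\<^sub>m\<close> with respect to the law with mean measure \<open>\<nu>\<^sub>m\<close>.\<close>

theorem poisson_mix_density:
  assumes "0 < \<xi>" "\<xi> < 1/2" "finite_measure \<pi>m" "finite_measure \<nu>m"
    and f: "is_density f \<pi>c \<kappa>" and g: "is_density g \<nu>c \<kappa>"
    and p: "is_density (mix_density \<xi> g f) \<pi>m \<kappa>" and q: "is_density (mix_density \<xi> f g) \<nu>m \<kappa>"
  shows "is_density (poisson_density (density_ratio (mix_density \<xi> g f) (mix_density \<xi> f g)) \<pi>m \<nu>m)
    (poisson_law \<pi>m) (poisson_law \<nu>m)"
proof (intro poisson_law_density density_ratio_is_density[OF p q] assms)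
  fix x assume "x \<in> space \<kappa>" "mix_density \<xi> f g x = 0"
  moreover have "0 \<le> f x" "0 \<le> g x" using f g \<open>x \<in> space \<kappa>\<close> by (auto simp: is_density_def)
  ultimately show "mix_density \<xi> g f x = 0" using assms(1,2) by (simp add: mix_density_zero_iff)
qed

section \<open>Independence of the Hellinger distance from the dominating measure\<close>

lemma sets_measure_sum [simp]: "sets (measure_sum \<mu> \<mu>') = sets \<mu>"
  by (simp add: measure_sum_def)

lemma emeasure_measure_sum:
  assumes s: "sets \<mu>' = sets \<mu>" and A: "A \<in> sets \<mu>"
  shows "emeasure (measure_sum \<mu> \<mu>') A = emeasure \<mu> A + emeasure \<mu>' A"
proof (rule emeasure_measure_of[OF measure_sum_def])
  show "countably_additive (sets (measure_sum \<mu> \<mu>')) (\<lambda>A. emeasure \<mu> A + emeasure \<mu>' A)"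
    unfolding countably_additive_def
  proof (intro allI impI)
    fix B :: "nat \<Rightarrow> 'a set"
    assume "range B \<subseteq> sets (measure_sum \<mu> \<mu>')" "disjoint_family B"
    then show "(\<Sum>i. emeasure \<mu> (B i) + emeasure \<mu>' (B i)) = emeasure \<mu> (\<Union>(range B)) + emeasure \<mu>' (\<Union>(range B))"
      using s by (subst suminf_add[symmetric]) (auto simp: suminf_emeasure)
  qed
qed (use A in \<open>auto simp: positive_def dest: sets.sets_into_space\<close>)

theorem hellinger_eq:
  assumes fin: "finite_measure \<mu>" "finite_measure \<mu>'"
    and p: "is_density p \<mu> \<nu>" and q: "is_density q \<mu>' \<nu>"
  shows "hellinger \<mu> \<mu>' = sqrt (1/2 * (\<integral>x. (sqrt (p x) - sqrt (q x))\<^sup>2 \<partial>\<nu>))"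
proof -
  have [measurable]: "p \<in> borel_measurable \<nu>" "q \<in> borel_measurable \<nu>"
    and nn: "\<And>x. x \<in> space \<nu> \<Longrightarrow> 0 \<le> p x" "\<And>x. x \<in> space \<nu> \<Longrightarrow> 0 \<le> q x"
    and mu: "\<mu> = density \<nu> (\<lambda>x. ennreal (p x))" and mu': "\<mu>' = density \<nu> (\<lambda>x. ennreal (q x))"
    using p q by (auto simp: is_density_def)
  have s: "sets \<mu> = sets \<nu>" "sets \<mu>' = sets \<nu>" by (simp_all add: mu mu')
  let ?s = "measure_sum \<mu> \<mu>'"
  have sum: "?s = density \<nu> (\<lambda>x. ennreal (p x + q x))"
  proof (rule measure_eqI)
    fix A assume "A \<in> sets ?s"
    then have A: "A \<in> sets \<mu>" "A \<in> sets \<nu>" by (simp_all add: s)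
    have "emeasure ?s A = (\<integral>\<^sup>+x. ennreal (p x) * indicator A x \<partial>\<nu>) + (\<integral>\<^sup>+x. ennreal (q x) * indicator A x \<partial>\<nu>)"
      using A by (subst emeasure_measure_sum) (simp_all add: s, simp add: mu mu' emeasure_density)
    also have "\<dots> = (\<integral>\<^sup>+x. ennreal (p x) * indicator A x + ennreal (q x) * indicator A x \<partial>\<nu>)"
      using A by (intro nn_integral_add[symmetric]) auto
    also have "\<dots> = (\<integral>\<^sup>+x. ennreal (p x + q x) * indicator A x \<partial>\<nu>)"
      using nn by (intro nn_integral_cong) (auto simp: ennreal_plus distrib_right)
    finally show "emeasure ?s A = emeasure (density \<nu> (\<lambda>x. ennreal (p x + q x))) A"
      using A by (simp add: emeasure_density)
  qed (simp add: s)
  have sn: "sets ?s = sets \<nu>" by (simp add: s)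
  have fs: "finite_measure ?s"
  proof (rule finite_measureI)
    have "space ?s = space \<mu>" by (rule sets_eq_imp_space_eq) simp
    moreover have "space \<mu>' = space \<mu>" using s by (intro sets_eq_imp_space_eq) simp
    ultimately show "emeasure ?s (space ?s) \<noteq> \<infinity>"
      using fin[THEN finite_measure.emeasure_finite]
        emeasure_measure_sum[of \<mu>' \<mu>, OF _ sets.top] s by simp
  qed
  have key: "AE x in \<nu>. (p x + q x) * enn2real (RN_deriv ?s \<rho> x) = r x"
    if r: "is_density r \<rho> \<nu>" and le: "\<And>x. x \<in> space \<nu> \<Longrightarrow> r x \<le> p x + q x" and frho: "finite_measure \<rho>" for \<rho> r
  proof -
    have [measurable]: "r \<in> borel_measurable \<nu>" and r0: "\<And>x. x \<in> space \<nu> \<Longrightarrow> 0 \<le> r x"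
      and rho: "\<rho> = density \<nu> (\<lambda>x. ennreal (r x))"
      using r by (auto simp: is_density_def)
    have Rm: "RN_deriv ?s \<rho> \<in> borel_measurable \<nu>"
      using borel_measurable_RN_deriv[of ?s \<rho>] by (simp add: measurable_cong_sets[OF sn refl])
    have "absolutely_continuous ?s \<rho>"
      unfolding absolutely_continuous_def
    proof
      fix N assume "N \<in> null_sets ?s"
      then have N: "N \<in> sets \<nu>" "AE x in \<nu>. x \<in> N \<longrightarrow> p x + q x \<le> 0"
        unfolding sum by (auto simp: null_sets_density_iff ennreal_eq_0_iff)
      have "AE x in \<nu>. x \<in> N \<longrightarrow> r x \<le> 0"
        using N(2) AE_space by eventually_elim (use le in force)
      then show "N \<in> null_sets \<rho>"
        using N(1) unfolding rho by (auto simp: null_sets_density_iff ennreal_eq_0_iff)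
    qed
    then have "density ?s (RN_deriv ?s \<rho>) = \<rho>"
      by (intro sigma_finite_measure.density_RN_deriv finite_measure.sigma_finite_measure fs) (auto simp: rho s)
    then have D: "density ?s (RN_deriv ?s \<rho>) = density \<nu> (\<lambda>x. ennreal (r x))"
      by (simp only: rho[symmetric])
    have "density ?s (RN_deriv ?s \<rho>) = density (density \<nu> (\<lambda>x. ennreal (p x + q x))) (RN_deriv ?s \<rho>)"
      by (rule arg_cong[where f = "\<lambda>S. density S _", OF sum])
    also have "\<dots> = density \<nu> (\<lambda>x. ennreal (p x + q x) * RN_deriv ?s \<rho> x)"
      by (rule density_density_eq) (use Rm in auto)
    finally have "density \<nu> (\<lambda>x. ennreal (r x)) = density \<nu> (\<lambda>x. ennreal (p x + q x) * RN_deriv ?s \<rho> x)"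
      using D by simp
    then have "AE x in \<nu>. ennreal (r x) = ennreal (p x + q x) * RN_deriv ?s \<rho> x"
      using Rm finite_measure.sigma_finite_measure[OF frho]
      by (subst (asm) sigma_finite_density_unique) (auto simp only: rho[symmetric], auto)
    then show ?thesis using AE_space
    proof eventually_elim
      case (elim x)
      have "enn2real (ennreal (r x)) = enn2real (ennreal (p x + q x) * RN_deriv ?s \<rho> x)"
        using elim(1) by simp
      then show ?case
        using nn[OF elim(2)] r0[OF elim(2)] by (simp add: enn2real_mult del: ennreal_plus)
    qed
  qed
  let ?a = "\<lambda>x. enn2real (RN_deriv ?s \<mu> x)" and ?b = "\<lambda>x. enn2real (RN_deriv ?s \<mu>' x)"
  have m: "(\<lambda>x. (sqrt (?a x) - sqrt (?b x))\<^sup>2) \<in> borel_measurable \<nu>"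
  proof -
    have "(\<lambda>x. (sqrt (?a x) - sqrt (?b x))\<^sup>2) \<in> borel_measurable ?s" by measurable
    then show ?thesis by (simp add: measurable_cong_sets[OF sn refl])
  qed
  have "(\<integral>x. (sqrt (?a x) - sqrt (?b x))\<^sup>2 \<partial>?s)
      = (\<integral>x. (sqrt (?a x) - sqrt (?b x))\<^sup>2 \<partial>density \<nu> (\<lambda>x. ennreal (p x + q x)))"
    by (rule arg_cong[where f = "\<lambda>S. integral\<^sup>L S _", OF sum])
  also have "\<dots> = (\<integral>x. (p x + q x) *\<^sub>R (sqrt (?a x) - sqrt (?b x))\<^sup>2 \<partial>\<nu>)"
    using nn by (intro integral_density m AE_I2) auto
  also have "\<dots> = (\<integral>x. (sqrt (p x) - sqrt (q x))\<^sup>2 \<partial>\<nu>)"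
  proof (intro integral_cong_AE)
    show "(\<lambda>x. (p x + q x) *\<^sub>R (sqrt (?a x) - sqrt (?b x))\<^sup>2) \<in> borel_measurable \<nu>"
      using m by measurable
    have "AE x in \<nu>. (p x + q x) * ?a x = p x" using nn by (intro key p fin) auto
    moreover have "AE x in \<nu>. (p x + q x) * ?b x = q x" using nn by (intro key q fin) auto
    ultimately show "AE x in \<nu>. (p x + q x) *\<^sub>R (sqrt (?a x) - sqrt (?b x))\<^sup>2 = (sqrt (p x) - sqrt (q x))\<^sup>2"
      using AE_space
    proof eventually_elim
      case (elim x)
      have "0 \<le> p x + q x" using nn[OF elim(3)] by simp
      then have "(p x + q x) * (sqrt (?a x) - sqrt (?b x))\<^sup>2
          = (sqrt (p x + q x) * sqrt (?a x) - sqrt (p x + q x) * sqrt (?b x))\<^sup>2"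
        by (simp add: right_diff_distrib[symmetric] power_mult_distrib)
      also have "\<dots> = (sqrt (p x) - sqrt (q x))\<^sup>2"
        unfolding real_sqrt_mult[symmetric] elim(1,2) ..
      finally show ?case by simp
    qed
  qed simp
  finally show ?thesis by (simp add: hellinger_def Let_def)
qed

end

theory Submission
  imports Defs
begin

text \<open>
  The error probability is bounded by Chernoff's method at exponent \<open>1/2\<close>: on the event that
  \<open>\<pi>\<^sub>c\<close> is chosen, \<open>T \<ge> 0\<close>, so its probability is at most the expectation of \<open>exp (T/2)\<close>, which is
  \<open>exp (- x)\<close> times the square root of the likelihood ratio. This variable is a constant times a
  product over the points of \<open>X\<close>, and Poisson processes turn expectations of products into
  exponentials of integrals (\<open>nn_integral_poisson_law_prod\<close>). What remains is an inequality between
  real numbers: with \<open>r\<close> the square root of \<open>d\<pi>\<^sub>m/d\<nu>\<^sub>m\<close>,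
  \<open>(\<nu>\<^sub>m(\<X>) - \<pi>\<^sub>m(\<X>))/2 + \<integral>(r - 1) d\<mu> \<le> - (1 - 2\<xi>)\<^sup>2 H\<^sup>2(\<pi>\<^sub>c, \<nu>\<^sub>c)\<close>.

  Take densities with respect to a measure that dominates \<open>\<mu>\<close> as well, and let \<open>a, b, u\<close> be the
  square roots of those of \<open>\<pi>\<^sub>c, \<nu>\<^sub>c, \<mu>\<close>. The square roots \<open>q\<close> and \<open>p\<close> of the densities of \<open>\<nu>\<^sub>m\<close> and \<open>\<pi>\<^sub>m\<close>
  divide the segment from \<open>b\<close> to \<open>a\<close> at the fractions \<open>\<xi>\<close> and \<open>1 - \<xi>\<close>, and \<open>r = p/q\<close> never exceeds
  \<open>(1 - \<xi>)/\<xi>\<close>. This boundedness makes the test robust: it controls \<open>\<integral>r d\<mu>\<close> even if \<open>\<nu>\<^sub>m\<close> does not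
  dominate \<open>\<mu>\<close>. Expand \<open>u\<^sup>2\<close> around \<open>q\<^sup>2\<close> and replace \<open>r (u - q)\<^sup>2\<close> by its upper bound. Because of the
  symmetric position of \<open>q\<close> and \<open>p\<close> all products \<open>(u - b) (a - b)\<close> cancel, and the integrand is at most
  \<open>(1 - 2\<xi>)/\<xi> (u - b)\<^sup>2 - (1 - 2\<xi>)/2 (a - b)\<^sup>2\<close> at every point (\<open>mixture_exponent_le\<close>). The integral
  of this bound is \<open>(1 - 2\<xi>) (2 H\<^sup>2(\<mu>, \<nu>\<^sub>c)/\<xi> - H\<^sup>2(\<pi>\<^sub>c, \<nu>\<^sub>c))\<close>, so \<open>H(\<mu>, \<nu>\<^sub>c) \<le> \<xi> H(\<pi>\<^sub>c, \<nu>\<^sub>c)\<close> gives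
  the constant \<open>- (1 - 2\<xi>)\<^sup>2\<close>. The second error bound is the first one with the two measures exchanged
  and \<open>x\<close> replaced by \<open>- x\<close>, which changes the sign of \<open>T\<close>.
\<close>

section \<open>Densities of finite measures\<close>

lemma is_density_integral:
  assumes "is_density p \<mu> \<nu>" "finite_measure \<mu>"
  shows "integrable \<nu> p" "integral\<^sup>L \<nu> p = measure \<mu> (space \<mu>)"
proof -
  interpret finite_measure \<mu> by fact
  have [measurable]: "p \<in> borel_measurable \<nu>" and p0: "\<And>x. x \<in> space \<nu> \<Longrightarrow> 0 \<le> p x"
    and mu: "\<mu> = density \<nu> (\<lambda>x. ennreal (p x))"
    using assms by (auto simp: is_density_def)
  have "(\<integral>\<^sup>+x. ennreal (p x) \<partial>\<nu>) = emeasure \<mu> (space \<mu>)"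
    unfolding mu by (simp add: emeasure_density cong: nn_integral_cong)
  then have "has_bochner_integral \<nu> p (measure \<mu> (space \<mu>))"
    using p0 by (intro has_bochner_integral_nn_integral AE_I2) (auto simp: emeasure_eq_measure)
  then show "integrable \<nu> p" "integral\<^sup>L \<nu> p = measure \<mu> (space \<mu>)"
    by (auto simp: has_bochner_integral_iff)
qed

lemma is_density_trans:
  assumes "is_density f \<mu> \<nu>" "is_density l \<nu> \<kappa>"
  shows "is_density (\<lambda>x. l x * f x) \<mu> \<kappa>"
proof -
  have nu: "\<nu> = density \<kappa> (\<lambda>x. ennreal (l x))" and l: "l \<in> borel_measurable \<kappa>"
    and l0: "\<And>x. x \<in> space \<kappa> \<Longrightarrow> 0 \<le> l x" using assms(2) by (auto simp: is_density_def)
  have f: "f \<in> borel_measurable \<kappa>" and f0: "\<And>x. x \<in> space \<kappa> \<Longrightarrow> 0 \<le> f x"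
    and mu: "\<mu> = density \<nu> (\<lambda>x. ennreal (f x))"
    using assms(1) by (auto simp: is_density_def nu)
  have "\<mu> = density \<kappa> (\<lambda>x. ennreal (l x) * ennreal (f x))"
    unfolding mu unfolding nu by (rule density_density_eq) (use l f in auto)
  also have "\<dots> = density \<kappa> (\<lambda>x. ennreal (l x * f x))"
    by (intro density_cong AE_I2) (use l f l0 in \<open>auto simp: ennreal_mult'\<close>)
  finally show ?thesis using l f l0 f0 by (auto simp: is_density_def)
qed

lemma finite_measure_measure_sum:
  assumes "finite_measure \<mu>" "finite_measure \<mu>'" "sets \<mu>' = sets \<mu>"
  shows "finite_measure (measure_sum \<mu> \<mu>')"
proof (rule finite_measureI)
  have sp: "space (measure_sum \<mu> \<mu>') = space \<mu>" by (rule sets_eq_imp_space_eq) simp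
  have "emeasure \<mu>' (space \<mu>) \<noteq> \<infinity>"
    using finite_measure.emeasure_finite[OF assms(2), of "space \<mu>"] by simp
  moreover have "emeasure \<mu> (space \<mu>) \<noteq> \<infinity>"
    using finite_measure.emeasure_finite[OF assms(1), of "space \<mu>"] by simp
  ultimately show "emeasure (measure_sum \<mu> \<mu>') (space (measure_sum \<mu> \<mu>')) \<noteq> \<infinity>"
    unfolding sp emeasure_measure_sum[OF assms(3) sets.top] by simp
qed

lemma is_density_exists:
  assumes "finite_measure \<mu>" "finite_measure \<nu>" "sets \<mu> = sets \<nu>"
    and "\<And>A. A \<in> sets \<nu> \<Longrightarrow> emeasure \<mu> A \<le> emeasure \<nu> A"
  obtains p where "is_density p \<mu> \<nu>"
proof -
  interpret N: finite_measure \<nu> by fact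
  have "emeasure \<mu> N = 0" if "N \<in> sets \<nu>" "emeasure \<nu> N = 0" for N
    using assms(4)[OF that(1)] that(2) by simp
  then have ac: "absolutely_continuous \<nu> \<mu>"
    using assms(3) by (auto simp: absolutely_continuous_def null_sets_def)
  obtain D where D: "D \<in> borel_measurable \<nu>" "AE x in \<nu>. RN_deriv \<nu> \<mu> x = ennreal (D x)" "\<And>x. 0 \<le> D x"
    using N.real_RN_deriv[OF assms(1) ac assms(3)] by metis
  have "\<mu> = density \<nu> (RN_deriv \<nu> \<mu>)"
    using N.density_RN_deriv[OF ac assms(3)] by simp
  also have "\<dots> = density \<nu> (\<lambda>x. ennreal (D x))"
    by (intro density_cong D) (use D in auto)
  finally show thesis using D by (intro that[of D]) (auto simp: is_density_def)
qed

lemma integrable_sqrt_diff_square: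
  assumes "integrable \<nu> p" "integrable \<nu> q" "\<And>x. x \<in> space \<nu> \<Longrightarrow> 0 \<le> p x" "\<And>x. x \<in> space \<nu> \<Longrightarrow> 0 \<le> q x"
  shows "integrable \<nu> (\<lambda>x. (sqrt (p x) - sqrt (q x))\<^sup>2)"
proof (rule Bochner_Integration.integrable_bound)
  show "integrable \<nu> (\<lambda>x. p x + q x)" using assms by simp
  have "(sqrt (p x) - sqrt (q x))\<^sup>2 \<le> p x + q x" if "x \<in> space \<nu>" for x
    using assms(3,4)[OF that] by (simp add: power2_diff)
  then show "AE x in \<nu>. norm ((sqrt (p x) - sqrt (q x))\<^sup>2) \<le> norm (p x + q x)"
    using assms(3,4) by (intro AE_I2) simp
qed (use assms(1,2)[THEN borel_measurable_integrable] in measurable)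

lemma hellinger_square:
  assumes "finite_measure \<mu>" "finite_measure \<mu>'" "is_density p \<mu> \<nu>" "is_density q \<mu>' \<nu>"
  shows "(hellinger \<mu> \<mu>')\<^sup>2 = (\<integral>x. (sqrt (p x) - sqrt (q x))\<^sup>2 \<partial>\<nu>) / 2"
  unfolding hellinger_eq[OF assms] by simp

lemma hellinger_nonneg: "0 \<le> hellinger \<mu> \<mu>'"
  by (simp add: hellinger_def Let_def)

lemma hellinger_commute:
  assumes "finite_measure \<mu>" "finite_measure \<mu>'" "is_density p \<mu> \<nu>" "is_density q \<mu>' \<nu>"
  shows "hellinger \<mu> \<mu>' = hellinger \<mu>' \<mu>"
  unfolding hellinger_eq[OF assms] hellinger_eq[OF assms(2,1,4,3)] by (simp add: power2_commute)

section \<open>Expectations of products over a Poisson process\<close>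

text \<open>A product over the points is, up to a constant, the density of the Poisson law with mean measure
  \<open>h \<mu>\<close> with respect to the one with mean measure \<open>\<mu>\<close>. Densities of probability measures integrate to
  one, so the constant gives the expectation.\<close>

lemma nn_integral_poisson_law_prod:
  assumes "finite_measure \<mu>" and int: "integrable \<mu> h" and h0: "\<And>x. x \<in> space \<mu> \<Longrightarrow> 0 \<le> h x"
  shows "(\<integral>\<^sup>+c. ennreal (\<Prod>x\<in>#c. h x) \<partial>poisson_law \<mu>) = ennreal (exp (integral\<^sup>L \<mu> h - measure \<mu> (space \<mu>)))"
proof -
  let ?m = "measure \<mu> (space \<mu>)" and ?\<mu>' = "density \<mu> (\<lambda>x. ennreal (h x))"
  let ?I = "integral\<^sup>L \<mu> h"
  have [measurable]: "h \<in> borel_measurable \<mu>" using int by simp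
  have d: "is_density h ?\<mu>' \<mu>" using h0 by (auto simp: is_density_def)
  have I: "(\<integral>\<^sup>+x. ennreal (h x) \<partial>\<mu>) = ennreal ?I"
    by (intro nn_integral_eq_integral int AE_I2 h0)
  have fin: "finite_measure ?\<mu>'"
    by (rule finite_measureI) (simp add: emeasure_density I cong: nn_integral_cong)
  have I': "measure ?\<mu>' (space ?\<mu>') = ?I"
    using is_density_integral(2)[OF d fin] by simp
  have "is_density (poisson_density h ?\<mu>' \<mu>) (poisson_law ?\<mu>') (poisson_law \<mu>)"
    by (rule poisson_law_density[OF assms(1) fin d])
  then have D: "poisson_density h ?\<mu>' \<mu> \<in> borel_measurable (poisson_law \<mu>)"
    and L: "poisson_law ?\<mu>' = density (poisson_law \<mu>) (\<lambda>c. ennreal (poisson_density h ?\<mu>' \<mu> c))"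
    by (auto simp: is_density_def)
  have "1 = emeasure (poisson_law ?\<mu>') (space (poisson_law ?\<mu>'))"
    by (rule prob_space.emeasure_space_1[OF prob_space_poisson_law[OF fin], symmetric])
  also have "\<dots> = (\<integral>\<^sup>+c. ennreal (poisson_density h ?\<mu>' \<mu> c) * indicator (space (poisson_law \<mu>)) c \<partial>poisson_law \<mu>)"
    unfolding L space_density by (rule emeasure_density[OF measurable_compose[OF D measurable_ennreal] sets.top])
  also have "\<dots> = (\<integral>\<^sup>+c. ennreal (poisson_density h ?\<mu>' \<mu> c) \<partial>poisson_law \<mu>)"
    by (intro nn_integral_cong) simp
  finally have one: "1 = (\<integral>\<^sup>+c. ennreal (poisson_density h ?\<mu>' \<mu> c) \<partial>poisson_law \<mu>)" .
  have "(\<integral>\<^sup>+c. ennreal (\<Prod>x\<in>#c. h x) \<partial>poisson_law \<mu>)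
      = (\<integral>\<^sup>+c. ennreal (exp (?I - ?m)) * ennreal (poisson_density h ?\<mu>' \<mu> c) \<partial>poisson_law \<mu>)"
    by (intro nn_integral_cong)
      (simp add: poisson_density_def I' ennreal_mult'[symmetric] mult.assoc[symmetric] mult_exp_exp del: space_density)
  also have "\<dots> = ennreal (exp (?I - ?m)) * 1"
    unfolding one using D by (intro nn_integral_cmult) auto
  finally show ?thesis by simp
qed

lemma sqrt_prod_mset: "sqrt (\<Prod>x\<in>#c. h x) = (\<Prod>x\<in>#c. sqrt (h x))"
  by (induction c) (auto simp: real_sqrt_mult)

text \<open>Markov's inequality for the square root of the likelihood ratio.\<close>

lemma poisson_likelihood_ratio_tail:
  assumes fin: "finite_measure \<mu>" and h: "h \<in> borel_measurable \<mu>" and h0: "\<And>y. y \<in> space \<mu> \<Longrightarrow> 0 \<le> h y"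
    and int: "integrable \<mu> (\<lambda>y. sqrt (h y))"
    and S: "S \<in> sets (config_space \<mu>)" "\<And>c. c \<in> S \<Longrightarrow> exp (2 * x) \<le> poisson_density h \<pi> \<nu> c"
  shows "measure (poisson_law \<mu>) S \<le> exp (- x + (measure \<nu> (space \<nu>) - measure \<pi> (space \<pi>)) / 2
      + (\<integral>y. sqrt (h y) \<partial>\<mu>) - measure \<mu> (space \<mu>))"
proof -
  interpret prob_space "poisson_law \<mu>" by (rule prob_space_poisson_law[OF fin])
  let ?C = "exp (- x + (measure \<nu> (space \<nu>) - measure \<pi> (space \<pi>)) / 2)"
  have G: "(\<lambda>c. ennreal (\<Prod>y\<in>#c. sqrt (h y))) \<in> borel_measurable (poisson_law \<mu>)"
    using measurable_prod_mset[of "\<lambda>y. sqrt (h y)" \<mu>] h by (auto cong: measurable_cong_sets)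
  have le: "1 \<le> ?C * (\<Prod>y\<in>#c. sqrt (h y))" if "c \<in> S" for c
  proof -
    have "sqrt (exp (2 * x)) = exp x" by (intro real_sqrt_unique) (auto simp: exp_double)
    moreover have "sqrt (exp t) = exp (t / 2)" for t :: real
      using exp_double[of "t / 2"] by (intro real_sqrt_unique) auto
    ultimately have "exp x \<le> exp ((measure \<nu> (space \<nu>) - measure \<pi> (space \<pi>)) / 2) * (\<Prod>y\<in>#c. sqrt (h y))"
      using real_sqrt_le_mono[OF S(2)[OF that]]
      by (simp add: poisson_density_def real_sqrt_mult sqrt_prod_mset)
    then have "exp (- x) * exp x \<le> exp (- x) * (exp ((measure \<nu> (space \<nu>) - measure \<pi> (space \<pi>)) / 2) * (\<Prod>y\<in>#c. sqrt (h y)))"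
      by (intro mult_left_mono) auto
    then show ?thesis by (simp add: mult_exp_exp mult.assoc[symmetric])
  qed
  have "emeasure (poisson_law \<mu>) S = (\<integral>\<^sup>+c. indicator S c \<partial>poisson_law \<mu>)"
    using S(1) by simp
  also have "\<dots> \<le> (\<integral>\<^sup>+c. ennreal ?C * ennreal (\<Prod>y\<in>#c. sqrt (h y)) \<partial>poisson_law \<mu>)"
  proof (intro nn_integral_mono)
    fix c
    have "1 \<le> ennreal ?C * ennreal (\<Prod>y\<in>#c. sqrt (h y))" if "c \<in> S"
      unfolding ennreal_mult'[OF exp_ge_zero, symmetric] using le[OF that] by simp
    then show "indicator S c \<le> ennreal ?C * ennreal (\<Prod>y\<in>#c. sqrt (h y))"
      by (auto simp: indicator_def)
  qed
  also have "\<dots> = ennreal ?C * ennreal (exp ((\<integral>y. sqrt (h y) \<partial>\<mu>) - measure \<mu> (space \<mu>)))"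
    using nn_integral_poisson_law_prod[OF fin int] h0 G by (simp add: nn_integral_cmult)
  also have "\<dots> = ennreal (exp (- x + (measure \<nu> (space \<nu>) - measure \<pi> (space \<pi>)) / 2
      + (\<integral>y. sqrt (h y) \<partial>\<mu>) - measure \<mu> (space \<mu>)))"
    by (simp add: ennreal_mult'[symmetric] mult_exp_exp add_diff_eq)
  finally show ?thesis by (simp add: emeasure_eq_measure)
qed

section \<open>The mixed densities\<close>

text \<open>The extreme values of the ratio are attained where one of the two densities vanishes. In the form
  \<open>r q = p\<close> the quotient is meaningful at common zeros, too.\<close>

lemma sqrt_mix_density_ratio:
  assumes "0 < \<xi>" "\<xi> < 1/2" "0 \<le> f y" "0 \<le> g y"
  defines "r \<equiv> sqrt (density_ratio (mix_density \<xi> g f) (mix_density \<xi> f g) y)"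
  shows "0 < r" "r \<le> (1 - \<xi>) / \<xi>"
    "r * (\<xi> * sqrt (f y) + (1 - \<xi>) * sqrt (g y)) = \<xi> * sqrt (g y) + (1 - \<xi>) * sqrt (f y)"
proof -
  let ?p = "\<xi> * sqrt (g y) + (1 - \<xi>) * sqrt (f y)" and ?q = "\<xi> * sqrt (f y) + (1 - \<xi>) * sqrt (g y)"
  have p0: "0 \<le> ?p" and q0: "0 \<le> ?q" using assms by auto
  have z: "?p = 0 \<longleftrightarrow> f y = 0 \<and> g y = 0" "?q = 0 \<longleftrightarrow> f y = 0 \<and> g y = 0"
    using assms by (auto simp: add_nonneg_eq_0_iff)
  have r: "r = (if f y = 0 \<and> g y = 0 then 1 else ?p / ?q)"
    using z p0 q0 by (auto simp: r_def density_ratio_def mix_density_def real_sqrt_divide)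
  have "?p * \<xi> \<le> (1 - \<xi>) * ?q"
  proof -
    have "\<xi> * \<xi> \<le> (1 - \<xi>) * (1 - \<xi>)" using assms(1,2) by (intro mult_mono) auto
    then have "\<xi> * \<xi> * sqrt (g y) \<le> (1 - \<xi>) * (1 - \<xi>) * sqrt (g y)"
      using assms by (intro mult_right_mono) auto
    then show ?thesis by (simp add: algebra_simps)
  qed
  then show "r \<le> (1 - \<xi>) / \<xi>"
    using z q0 assms(1,2) by (auto simp: r field_simps)
  show "0 < r" using z p0 q0 by (auto simp: r intro!: divide_pos_pos simp: less_le)
  show "r * ?q = ?p" using z by (auto simp: r)
qed

text \<open>With \<open>p = \<xi> b + (1 - \<xi>) a\<close> and \<open>q = \<xi> a + (1 - \<xi>) b\<close>, the equation \<open>r q = p\<close> gives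
  \<open>r u\<^sup>2 = r (u - q)\<^sup>2 + 2 p u - p q\<close>. Only the first summand involves \<open>r\<close>, and
  once its factor \<open>r\<close> is replaced by \<open>(1 - \<xi>)/\<xi>\<close>, the two sides of the claim agree.\<close>

lemma mixture_exponent_le:
  fixes a b u r \<xi> :: real
  assumes "0 < \<xi>" and r: "r \<le> (1 - \<xi>) / \<xi>"
    and rq: "r * (\<xi> * a + (1 - \<xi>) * b) = \<xi> * b + (1 - \<xi>) * a"
  shows "((\<xi> * a + (1 - \<xi>) * b)\<^sup>2 - (\<xi> * b + (1 - \<xi>) * a)\<^sup>2) / 2 + (r - 1) * u\<^sup>2
    \<le> (1 - 2 * \<xi>) / \<xi> * (u - b)\<^sup>2 - (1 - 2 * \<xi>) / 2 * (a - b)\<^sup>2"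
proof -
  define q where "q = \<xi> * a + (1 - \<xi>) * b"
  define p where "p = \<xi> * b + (1 - \<xi>) * a"
  have rq': "r * q = p" using rq by (simp add: p_def q_def)
  have "r * u\<^sup>2 = r * (u - q)\<^sup>2 + 2 * (r * q) * u - (r * q) * q"
    by (simp add: power2_eq_square algebra_simps)
  also have "\<dots> \<le> (1 - \<xi>) / \<xi> * (u - q)\<^sup>2 + 2 * p * u - p * q"
    unfolding rq' using mult_right_mono[OF r, of "(u - q)\<^sup>2"] by simp
  finally have "(q\<^sup>2 - p\<^sup>2) / 2 + (r - 1) * u\<^sup>2
      \<le> (q\<^sup>2 - p\<^sup>2) / 2 + (1 - \<xi>) / \<xi> * (u - q)\<^sup>2 + 2 * p * u - p * q - u\<^sup>2"
    by (simp add: algebra_simps)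
  also have "\<dots> = (1 - 2 * \<xi>) / \<xi> * (u - b)\<^sup>2 - (1 - 2 * \<xi>) / 2 * (a - b)\<^sup>2"
    using assms(1) unfolding p_def q_def by (simp add: field_simps power2_eq_square)
  finally show ?thesis by (simp add: p_def q_def)
qed

section \<open>The error bounds\<close>

text \<open>In the integral of the pointwise bound the two squares become Hellinger distances. The densities
  \<open>f\<close> and \<open>g\<close> say nothing about \<open>\<mu>\<close> where it is singular to \<open>lam\<close>; there the densities of \<open>\<pi>\<^sub>c\<close>
  and \<open>\<nu>\<^sub>c\<close> vanish, \<open>r q = p\<close> reads \<open>0 = 0\<close>, and the bound on \<open>r\<close> suffices.\<close>

lemma integral_mixture_exponent_le:
  assumes fin: "finite_measure \<pi>c" "finite_measure \<nu>c" "finite_measure \<pi>m" "finite_measure \<nu>m"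
      "finite_measure lam" "finite_measure \<mu>"
    and xi: "0 < \<xi>" "\<xi> < 1/2"
    and f: "is_density f \<pi>c lam" and g: "is_density g \<nu>c lam"
    and pm: "is_density (mix_density \<xi> g f) \<pi>m lam" and qm: "is_density (mix_density \<xi> f g) \<nu>m lam"
    and s: "sets \<mu> = sets lam"
    and H: "hellinger \<mu> \<nu>c \<le> \<xi> * hellinger \<pi>c \<nu>c"
  defines "r \<equiv> \<lambda>y. sqrt (density_ratio (mix_density \<xi> g f) (mix_density \<xi> f g) y)"
  shows "integrable \<mu> r"
    "(measure \<nu>m (space \<nu>m) - measure \<pi>m (space \<pi>m)) / 2 + integral\<^sup>L \<mu> r - measure \<mu> (space \<mu>)
      \<le> - (1 - 2 * \<xi>)\<^sup>2 * (hellinger \<pi>c \<nu>c)\<^sup>2"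
proof -
  (* lam need not dominate \<mu>, so the densities are moved to a measure that dominates both *)
  define \<kappa> where "\<kappa> = measure_sum lam \<mu>"
  have s\<kappa>: "sets \<kappa> = sets lam" by (simp add: \<kappa>_def)
  have sp: "space \<kappa> = space lam" "space \<mu> = space lam"
    using s\<kappa> s by (auto dest: sets_eq_imp_space_eq)
  have fk: "finite_measure \<kappa>"
    unfolding \<kappa>_def by (intro finite_measure_measure_sum fin s)
  have em: "emeasure \<kappa> A = emeasure lam A + emeasure \<mu> A" if "A \<in> sets lam" for A
    unfolding \<kappa>_def by (rule emeasure_measure_sum[OF s that])
  obtain l where l: "is_density l lam \<kappa>"
    using is_density_exists[OF fin(5) fk] s\<kappa> em by auto
  obtain m where m: "is_density m \<mu> \<kappa>"
    using is_density_exists[OF fin(6) fk] s\<kappa> s em by auto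
  note F = is_density_trans[OF f l] and G = is_density_trans[OF g l]
    and PM = is_density_trans[OF pm l] and QM = is_density_trans[OF qm l]
  have f0: "0 \<le> f y" "0 \<le> g y" "0 \<le> l y" "0 \<le> m y" if "y \<in> space \<kappa>" for y
    using that f g l m unfolding is_density_def sp by blast+
  have [measurable]: "m \<in> borel_measurable \<kappa>" and mu: "\<mu> = density \<kappa> (\<lambda>y. ennreal (m y))"
    using m by (auto simp: is_density_def)
  have "mix_density \<xi> g f \<in> borel_measurable \<kappa>" "mix_density \<xi> f g \<in> borel_measurable \<kappa>"
    using pm qm by (auto simp: is_density_def measurable_cong_sets[OF s\<kappa> refl])
  then have rm[measurable]: "r \<in> borel_measurable \<kappa>"
    unfolding r_def density_ratio_def by measurable
  have rb: "0 < r y" "r y \<le> (1 - \<xi>) / \<xi>"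
    "r y * (\<xi> * sqrt (f y) + (1 - \<xi>) * sqrt (g y)) = \<xi> * sqrt (g y) + (1 - \<xi>) * sqrt (f y)"
    if "y \<in> space \<kappa>" for y
    unfolding r_def using sqrt_mix_density_ratio[of \<xi> f y g, OF xi f0(1,2)[OF that]] by auto
  have "r \<in> borel_measurable \<mu>" using rm by (simp add: measurable_cong_sets[of \<mu> \<kappa>] s s\<kappa>)
  then show ir: "integrable \<mu> r"
    using rb by (intro finite_measure.integrable_const_bound[OF fin(6), of _ "(1 - \<xi>) / \<xi>"] AE_I2)
      (auto simp: sp abs_of_pos)
  have imr: "integrable \<kappa> (\<lambda>y. m y * r y)"
    using ir unfolding mu by (subst (asm) integrable_density) (auto simp: f0 intro!: AE_I2)
  have Imr: "integral\<^sup>L \<mu> r = (\<integral>y. m y * r y \<partial>\<kappa>)"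
    unfolding mu by (subst integral_density) (auto simp: f0 intro!: AE_I2)
  note im = is_density_integral[OF m fin(6)] and ip = is_density_integral[OF PM fin(3)]
    and iq = is_density_integral[OF QM fin(4)]
  let ?U = "\<lambda>y. (sqrt (m y) - sqrt (l y * g y))\<^sup>2" and ?V = "\<lambda>y. (sqrt (l y * f y) - sqrt (l y * g y))\<^sup>2"
  have iU: "integrable \<kappa> ?U" and iV: "integrable \<kappa> ?V"
    using is_density_integral(1)[OF F fin(1)] is_density_integral(1)[OF G fin(2)] im(1) f0
    by (auto intro!: integrable_sqrt_diff_square)
  have "(measure \<nu>m (space \<nu>m) - measure \<pi>m (space \<pi>m)) / 2 + integral\<^sup>L \<mu> r - measure \<mu> (space \<mu>)
    = (\<integral>y. (l y * mix_density \<xi> f g y - l y * mix_density \<xi> g f y) / 2 + m y * r y - m y \<partial>\<kappa>)"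
    using im ip iq imr by (simp add: Imr)
  also have "\<dots> \<le> (\<integral>y. (1 - 2 * \<xi>) / \<xi> * ?U y - (1 - 2 * \<xi>) / 2 * ?V y \<partial>\<kappa>)"
  proof (rule integral_mono)
    fix y assume y: "y \<in> space \<kappa>"
    let ?a = "sqrt (l y * f y)" and ?b = "sqrt (l y * g y)"
    have sq: "\<xi> * sqrt (l y * s') + (1 - \<xi>) * sqrt (l y * t') = sqrt (l y) * (\<xi> * sqrt s' + (1 - \<xi>) * sqrt t')" for s' t'
      by (simp add: real_sqrt_mult algebra_simps)
    have "r y * (\<xi> * ?a + (1 - \<xi>) * ?b) = \<xi> * ?b + (1 - \<xi>) * ?a"
      unfolding sq using rb(3)[OF y] by (simp add: mult.left_commute)
    from mixture_exponent_le[OF xi(1) rb(2)[OF y] this, of "sqrt (m y)"]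
    show "(l y * mix_density \<xi> f g y - l y * mix_density \<xi> g f y) / 2 + m y * r y - m y
        \<le> (1 - 2 * \<xi>) / \<xi> * ?U y - (1 - 2 * \<xi>) / 2 * ?V y"
      unfolding sq using f0[OF y]
      by (simp add: mix_density_def power_mult_distrib left_diff_distrib mult.commute[of "r y"])
  qed (use im ip iq imr iU iV in auto)
  also have "\<dots> = (1 - 2 * \<xi>) / \<xi> * (2 * (hellinger \<mu> \<nu>c)\<^sup>2) - (1 - 2 * \<xi>) * (hellinger \<pi>c \<nu>c)\<^sup>2"
    unfolding hellinger_square[OF fin(6,2) m G] hellinger_square[OF fin(1,2) F G] using iU iV by simp
  also have "\<dots> \<le> (1 - 2 * \<xi>) / \<xi> * (2 * (\<xi> * hellinger \<pi>c \<nu>c)\<^sup>2) - (1 - 2 * \<xi>) * (hellinger \<pi>c \<nu>c)\<^sup>2"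
    using power_mono[OF H hellinger_nonneg, of 2] xi by (intro diff_right_mono mult_left_mono) auto
  also have "\<dots> = - (1 - 2 * \<xi>)\<^sup>2 * (hellinger \<pi>c \<nu>c)\<^sup>2"
    using xi by (simp add: field_simps power2_eq_square)
  finally show "(measure \<nu>m (space \<nu>m) - measure \<pi>m (space \<pi>m)) / 2 + integral\<^sup>L \<mu> r - measure \<mu> (space \<mu>)
      \<le> - (1 - 2 * \<xi>)\<^sup>2 * (hellinger \<pi>c \<nu>c)\<^sup>2" .
qed

text \<open>The event is any \<open>S\<close> on which the test statistic is nonnegative, so that the bound covers every
  choice at \<open>T = 0\<close> and, after exchanging the measures, the other error as well.\<close>

lemma mixture_test_error:
  assumes fin: "finite_measure \<pi>c" "finite_measure \<nu>c" "finite_measure \<pi>m" "finite_measure \<nu>m"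
      "finite_measure lam" "finite_measure \<mu>"
    and xi: "0 < \<xi>" "\<xi> < 1/2"
    and f: "is_density f \<pi>c lam" and g: "is_density g \<nu>c lam"
    and pm: "is_density (mix_density \<xi> g f) \<pi>m lam" and qm: "is_density (mix_density \<xi> f g) \<nu>m lam"
    and s: "sets \<mu> = sets lam"
    and H: "hellinger \<mu> \<nu>c \<le> \<xi> * hellinger \<pi>c \<nu>c"
    and S: "S \<in> sets (config_space \<mu>)"
      "\<And>c. c \<in> S \<Longrightarrow> exp (2 * x)
        \<le> poisson_density (density_ratio (mix_density \<xi> g f) (mix_density \<xi> f g)) \<pi>m \<nu>m c"
  shows "measure (poisson_law \<mu>) S \<le> exp (- x - (1 - 2 * \<xi>)\<^sup>2 * (hellinger \<pi>c \<nu>c)\<^sup>2)"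
proof -
  let ?h = "density_ratio (mix_density \<xi> g f) (mix_density \<xi> f g)"
  note I = integral_mixture_exponent_le[OF fin xi f g pm qm s H]
  have "mix_density \<xi> g f \<in> borel_measurable \<mu>" "mix_density \<xi> f g \<in> borel_measurable \<mu>"
    using pm qm by (auto simp: is_density_def measurable_cong_sets[OF s refl])
  then have h: "?h \<in> borel_measurable \<mu>"
    unfolding density_ratio_def[abs_def] by measurable
  have h0: "0 \<le> ?h y" for y
    by (auto simp: density_ratio_def mix_density_def)
  have "measure (poisson_law \<mu>) S \<le> exp (- x + (measure \<nu>m (space \<nu>m) - measure \<pi>m (space \<pi>m)) / 2
      + (\<integral>y. sqrt (?h y) \<partial>\<mu>) - measure \<mu> (space \<mu>))"
    by (rule poisson_likelihood_ratio_tail[OF fin(6) h h0 I(1) S])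
  also have "\<dots> \<le> exp (- x - (1 - 2 * \<xi>)\<^sup>2 * (hellinger \<pi>c \<nu>c)\<^sup>2)"
    unfolding exp_le_cancel_iff using I(2) by linarith
  finally show ?thesis .
qed

lemma poisson_density_pos:
  assumes "\<And>y. y \<in># c \<Longrightarrow> 0 < h y"
  shows "0 < poisson_density h \<mu> \<nu> c"
proof -
  have "0 < (\<Prod>y\<in>#c. h y)" using assms by (induction c) auto
  then show ?thesis by (simp add: poisson_density_def)
qed

text \<open>Exchanging the two measures inverts the likelihood ratio, also at common zeros of the densities
  because of the convention \<open>0/0 = 1\<close>. This turns one error bound into the other.\<close>

lemma poisson_density_ratio_swap:
  "poisson_density (density_ratio q p) \<nu> \<mu> c = inverse (poisson_density (density_ratio p q) \<mu> \<nu> c)"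
proof -
  have "density_ratio q p y = inverse (density_ratio p q y)" for y
    by (auto simp: density_ratio_def)
  moreover have "(\<Prod>y\<in>#c. inverse (density_ratio p q y)) = inverse (\<Prod>y\<in>#c. density_ratio p q y)"
    by (induction c) auto
  ultimately show ?thesis
    by (simp add: poisson_density_def exp_minus[symmetric])
qed

theorem corollary6:
  fixes M lam \<pi>c \<nu>c \<pi>m \<nu>m \<mu> :: "'a measure" and f g :: "'a \<Rightarrow> real" and \<xi> x :: real
    and T :: "'a multiset \<Rightarrow> real" and \<psi> :: "'a multiset \<Rightarrow> decision"
    and P :: "'w measure" and X :: "'w \<Rightarrow> 'a multiset"
  assumes "\<pi>c \<in> finite_measures M" and "\<nu>c \<in> finite_measures M"
    and "0 < \<xi>" and "\<xi> < 1/2"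
    and "lam \<in> finite_measures M" and "is_density f \<pi>c lam" and "is_density g \<nu>c lam"
    and "\<pi>m \<in> finite_measures M" and "is_density (mix_density \<xi> g f) \<pi>m lam"
    and "\<nu>m \<in> finite_measures M" and "is_density (mix_density \<xi> f g) \<nu>m lam"
    and "T = (\<lambda>c. ln (poisson_density (density_ratio (mix_density \<xi> g f) (mix_density \<xi> f g)) \<pi>m \<nu>m c) - 2 * x)"
    and "\<psi> \<in> config_space M \<rightarrow>\<^sub>M count_space UNIV"
    and "\<And>c. c \<in> space (config_space M) \<Longrightarrow> T c > 0 \<Longrightarrow> \<psi> c = Choose_pi"
    and "\<And>c. c \<in> space (config_space M) \<Longrightarrow> T c < 0 \<Longrightarrow> \<psi> c = Choose_nu"
    and "\<mu> \<in> finite_measures M" and "poisson_process P X \<mu>"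
  shows "(hellinger \<mu> \<nu>c \<le> \<xi> * hellinger \<pi>c \<nu>c \<longrightarrow>
        measure P {\<omega> \<in> space P. \<psi> (X \<omega>) = Choose_pi}
          \<le> exp (- x - (1 - 2 * \<xi>)\<^sup>2 * (hellinger \<pi>c \<nu>c)\<^sup>2)) \<and>
    (hellinger \<mu> \<pi>c \<le> \<xi> * hellinger \<pi>c \<nu>c \<longrightarrow>
        measure P {\<omega> \<in> space P. \<psi> (X \<omega>) = Choose_nu}
          \<le> exp (x - (1 - 2 * \<xi>)\<^sup>2 * (hellinger \<pi>c \<nu>c)\<^sup>2))"
proof -
  have fin: "finite_measure \<pi>c" "finite_measure \<nu>c" "finite_measure \<pi>m" "finite_measure \<nu>m"
      "finite_measure lam" "finite_measure \<mu>"
    and sets: "sets lam = sets M" "sets \<mu> = sets M"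
    using assms(1,2,5,8,10,16) by (auto simp: finite_measures_def)
  note xi = assms(3,4) and f = assms(6) and g = assms(7) and pm = assms(9) and qm = assms(11)
    and T = assms(12) and \<psi> = assms(13) and psi_pi = assms(14) and psi_nu = assms(15)
  let ?h = "density_ratio (mix_density \<xi> g f) (mix_density \<xi> f g)"
  let ?L = "poisson_density ?h \<pi>m \<nu>m"
  have sl: "sets \<mu> = sets lam" using sets by simp
  have sc: "sets (config_space \<mu>) = sets (config_space M)" by (rule sets_config_space_cong[OF sets(2)])
  have spc: "space (config_space \<mu>) = space (config_space M)" by (rule sets_eq_imp_space_eq[OF sc])
  have X: "X \<in> P \<rightarrow>\<^sub>M config_space \<mu>" and law: "distr P (config_space \<mu>) X = poisson_law \<mu>"
    using assms(17) by (auto simp: poisson_process_def)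
  let ?S = "\<lambda>d. {c \<in> space (config_space M). \<psi> c = d}"
  have S: "?S d \<in> sets (config_space \<mu>)" for d
    unfolding sc using measurable_sets[OF \<psi>, of "{d}"] by (simp add: vimage_def Int_def conj_commute)
  have err: "measure P {\<omega> \<in> space P. \<psi> (X \<omega>) = d} = measure (poisson_law \<mu>) (?S d)" for d
  proof -
    have "measure (poisson_law \<mu>) (?S d) = measure P (X -` ?S d \<inter> space P)"
      unfolding law[symmetric] by (rule measure_distr[OF X S])
    also have "X -` ?S d \<inter> space P = {\<omega> \<in> space P. \<psi> (X \<omega>) = d}"
      using measurable_space[OF X] unfolding spc by blast
    finally show ?thesis by simp
  qed
  have Lpos: "0 < ?L c" if "c \<in> space (config_space M)" for c
  proof (rule poisson_density_pos)
    fix y assume "y \<in># c"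
    then have "y \<in> space lam" using that sets_eq_imp_space_eq[OF sets(1)] by auto
    then have "0 \<le> f y" "0 \<le> g y" using f g by (auto simp: is_density_def)
    from sqrt_mix_density_ratio(1)[of \<xi> f y g, OF xi this] show "0 < ?h y" by simp
  qed
  show ?thesis unfolding err
  proof (intro conjI impI)
    assume H: "hellinger \<mu> \<nu>c \<le> \<xi> * hellinger \<pi>c \<nu>c"
    show "measure (poisson_law \<mu>) (?S Choose_pi) \<le> exp (- x - (1 - 2 * \<xi>)\<^sup>2 * (hellinger \<pi>c \<nu>c)\<^sup>2)"
    proof (rule mixture_test_error[OF fin xi f g pm qm sl H S])
      fix c assume c: "c \<in> ?S Choose_pi"
      then have "\<not> T c < 0" using psi_nu[of c] by auto
      then have "2 * x \<le> ln (?L c)" by (simp add: T)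
      then show "exp (2 * x) \<le> ?L c" using Lpos[of c] c by (simp add: ln_ge_iff)
    qed
  next
    have comm: "hellinger \<pi>c \<nu>c = hellinger \<nu>c \<pi>c"
      by (rule hellinger_commute[OF fin(1,2) f g])
    assume "hellinger \<mu> \<pi>c \<le> \<xi> * hellinger \<pi>c \<nu>c"
    then have H: "hellinger \<mu> \<pi>c \<le> \<xi> * hellinger \<nu>c \<pi>c" by (simp add: comm)
    have "measure (poisson_law \<mu>) (?S Choose_nu) \<le> exp (- (- x) - (1 - 2 * \<xi>)\<^sup>2 * (hellinger \<nu>c \<pi>c)\<^sup>2)"
    proof (rule mixture_test_error[OF fin(2,1,4,3,5,6) xi g f qm pm sl H S])
      fix c assume c: "c \<in> ?S Choose_nu"
      then have "\<not> 0 < T c" using psi_pi[of c] by auto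
      then have "ln (?L c) \<le> 2 * x" by (simp add: T)
      then have "?L c \<le> exp (2 * x)" using Lpos[of c] c exp_le_cancel_iff[of "ln (?L c)" "2 * x"] by simp
      then have "inverse (exp (2 * x)) \<le> inverse (?L c)" using Lpos[of c] c by (intro le_imp_inverse_le) auto
      then show "exp (2 * - x)
          \<le> poisson_density (density_ratio (mix_density \<xi> f g) (mix_density \<xi> g f)) \<nu>m \<pi>m c"
        unfolding poisson_density_ratio_swap[of "mix_density \<xi> f g"] by (simp add: exp_minus)
    qed
    then show "measure (poisson_law \<mu>) (?S Choose_nu) \<le> exp (x - (1 - 2 * \<xi>)\<^sup>2 * (hellinger \<pi>c \<nu>c)\<^sup>2)"
      by (simp add: comm)
  qed
qed

end
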